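(* Let $G$ be a connected graph, let $B\subseteq V(G)$ be nonempty, let $\mathcal{S}=(S_1,\dots,S_s)$ be an ordered state list for $B$ with $s$ states, and let $M=M(G,\mathcal{S})$ be the $s\times s$ Markov transition matrix of the probabilistic zero forcing process on $G$ started from $B$. Let $\mathbf{1}=[1,\dots,1]^T\in\mathbb{R}^s$ and $\mathbf{e}_s=[0,\dots,0,1]^T\in\mathbb{R}^s$, and let $I$ be the $s\times s$ identity matrix. Then \[\operatorname{ept}(G,B)=\left((M-\mathbf{1}\mathbf{e}_s^T-I)^{-1}\right)_{1s}+1.\]
   Context: Graphs are finite, simple and undirected. $N[u]=N(u)\cup\{u\}$ is the closed neighborhood of $u$. Probabilistic zero forcing: each vertex of a connected graph $G$ is blue or white. In one round, with $C$ the set of vertices that are blue at the start of the round, every blue vertex $u$ attempts to force each of its white neighbors $w$, all attempts being independent, each succeeding with probability $\Pr(u\to w)=\frac{|N[u]\cap C|}{\deg u}$. A white vertex becomes blue in the round if at least one blue neighbor succeeds in forcing it; blue vertices stay blue. For a nonempty set $B$ of vertices, $\operatorname{pt}_{pzf}(G,B)$ is the random number of the round in which the last white vertex turns blue when initially exactly the vertices in $B$ are blue (it is $0$ if $B=V(G)$), and $\operatorname{ept}(G,B)=\mathbf{E}[\operatorname{pt}_{pzf}(G,B)]$. A simple state for $B$ is a coloring of the vertices that can be reached (with positive probability) by starting with exactly the vertices in $B$ blue and applying rounds of the process iteratively. Simple states that behave analogously may be combined into one state for $B$: that is, the states are the classes of a partition of the set of simple states such that all simple states in one class have the same number of blue vertices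 and, for any two classes $S,S'$, the probability of moving in one round from a simple state in $S$ to some simple state in $S'$ is the same for every simple state in $S$. An ordered state list for $B$ is an ordered list $\mathcal{S}=(S_1,\dots,S_s)$ of all states for $B$ in which $S_1$ is the initial state (exactly the vertices of $B$ are blue), $S_s$ is the final state (all vertices blue), and $S_2,\dots,S_{s-1}$ are in some chosen order. $M(G,\mathcal{S})$ is the $s\times s$ matrix whose $(i,j)$ entry is the probability of moving from $S_i$ to $S_j$ in one round. *)

theory Defs
  imports
    "HOL-Probability.Probability"
    "Graph_Theory.Graph_Theory"
    "Jordan_Normal_Form.Gauss_Jordan_Elimination"
begin

text \<open>
  A finite simple undirected graph is a \<^locale>\<open>pair_graph\<close>, that is, a finite, symmetric,
  irreflexive set of pairs \<^const>\<open>parcs\<close> over the finite vertex set \<^const>\<open>pverts\<close>.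
\<close>

definition neighbors :: "'a pair_pre_digraph \<Rightarrow> 'a \<Rightarrow> 'a set" where
  "neighbors G u = {w. (u, w) \<in> parcs G}"

definition closed_neighborhood :: "'a pair_pre_digraph \<Rightarrow> 'a \<Rightarrow> 'a set" where
  "closed_neighborhood G u = insert u (neighbors G u)"

definition force_prob :: "'a pair_pre_digraph \<Rightarrow> 'a set \<Rightarrow> 'a \<Rightarrow> real" where
  "force_prob G C u =
     real (card (closed_neighborhood G u \<inter> C)) / real (card (neighbors G u))"

text \<open>
  The randomness of one round is a family \<open>U\<close> of independent variables, uniform on the unit
  interval, one for each ordered pair \<open>(u, w)\<close> of adjacent vertices.  The attempt of \<open>u\<close> to force
  \<open>w\<close> succeeds iff \<open>U (u, w)\<close> is at most the required success probability.
\<close>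

definition attempt_space :: "'a pair_pre_digraph \<Rightarrow> ('a \<times> 'a \<Rightarrow> real) measure" where
  "attempt_space G = (\<Pi>\<^sub>M e\<in>parcs G. uniform_measure lborel {0..1})"

definition pzf_round :: "'a pair_pre_digraph \<Rightarrow> ('a \<times> 'a \<Rightarrow> real) \<Rightarrow> 'a set \<Rightarrow> 'a set" where
  "pzf_round G U C =
     C \<union> {w \<in> pverts G - C. \<exists>u\<in>C. w \<in> neighbors G u \<and> U (u, w) \<le> force_prob G C u}"

lemma prob_space_attempts: "prob_space (uniform_measure lborel {0..1::real})"
  by (rule prob_space_uniform_measure) auto

text \<open>The attempts have the intended success probabilities and are independent.\<close>

lemma force_prob_bounds:
  assumes "pair_graph G" and "u \<in> C" and "w \<in> neighbors G u" and "w \<notin> C"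
  shows "0 < force_prob G C u" and "force_prob G C u \<le> 1"
proof -
  interpret pair_graph G by fact
  have fin: "finite (neighbors G u)"
    by (rule finite_subset[of _ "snd ` parcs G"])
      (force simp: neighbors_def intro: pair_finite_arcs)+
  have u: "u \<notin> neighbors G u"
    using no_loops' by (auto simp: neighbors_def)
  have "closed_neighborhood G u \<inter> C \<subseteq> insert u (neighbors G u - {w})"
    using assms by (auto simp: closed_neighborhood_def)
  then have "card (closed_neighborhood G u \<inter> C) \<le> card (insert u (neighbors G u - {w}))"
    using fin by (intro card_mono) auto
  also have "\<dots> = card (neighbors G u)"
    using fin u assms(3) by (metis Diff_iff card.remove card_insert_disjoint finite_Diff)
  finally have le: "card (closed_neighborhood G u \<inter> C) \<le> card (neighbors G u)" .
  have "finite (closed_neighborhood G u \<inter> C)" "u \<in> closed_neighborhood G u \<inter> C"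
    using fin assms by (auto simp: closed_neighborhood_def)
  then have pos: "0 < card (closed_neighborhood G u \<inter> C)"
    by (auto simp: card_gt_0_iff)
  show "0 < force_prob G C u" "force_prob G C u \<le> 1"
    using le pos by (auto simp: force_prob_def)
qed

lemma prob_attempt:
  assumes "(u, w) \<in> parcs G" and "0 \<le> p" and "p \<le> 1"
  shows "measure (attempt_space G) {U \<in> space (attempt_space G). U (u, w) \<le> p} = p"
proof -
  let ?u = "uniform_measure lborel {0..1::real}"
  have d: "distr (attempt_space G) ?u (\<lambda>U. U (u, w)) = ?u"
    unfolding attempt_space_def
    by (rule distr_PiM_component[OF prob_space_attempts assms(1)])
  have "measure (attempt_space G) {U \<in> space (attempt_space G). U (u, w) \<le> p} =
      measure (distr (attempt_space G) ?u (\<lambda>U. U (u, w))) {..p}"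
    unfolding attempt_space_def
    by (subst measure_distr) (auto simp: assms(1) vimage_def Int_def
        intro!: arg_cong[where f = "measure _"])
  also have "\<dots> = measure lborel ({0..1} \<inter> {..p}) / measure lborel {0..1::real}"
    unfolding d by (rule measure_uniform_measure) auto
  also have "{0..1} \<inter> {..p} = {0..p}"
    using assms by auto
  finally show ?thesis using assms by simp
qed

lemma indep_attempts:
  "prob_space.indep_vars (attempt_space G) (\<lambda>_. borel) (\<lambda>e U. U e) (parcs G)"
proof (cases "parcs G = {}")
  case True
  interpret P: prob_space "attempt_space G"
    unfolding attempt_space_def by (intro prob_space_PiM prob_space_attempts)
  show ?thesis using True by (simp add: P.indep_vars_def P.indep_sets_def)
next
  case False
  let ?u = "uniform_measure lborel {0..1::real}"
  interpret P: prob_space "attempt_space G"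
    unfolding attempt_space_def by (intro prob_space_PiM prob_space_attempts)
  have "P.indep_vars (\<lambda>_. ?u) (\<lambda>e U. U e) (parcs G)"
  proof (subst P.indep_vars_iff_distr_eq_PiM'[OF False])
    show "P.random_variable ?u (\<lambda>U. U e)" if "e \<in> parcs G" for e
      using that unfolding attempt_space_def by simp
    have "distr (attempt_space G) (\<Pi>\<^sub>M e\<in>parcs G. ?u) (\<lambda>U. \<lambda>e\<in>parcs G. U e)
        = distr (attempt_space G) (attempt_space G) (\<lambda>U. U)"
      by (intro distr_cong)
        (auto simp: attempt_space_def space_PiM intro: PiE_restrict)
    also have "\<dots> = (\<Pi>\<^sub>M e\<in>parcs G. distr (attempt_space G) ?u (\<lambda>U. U e))"
      unfolding attempt_space_def
      by (auto intro!: PiM_cong simp: distr_PiM_component[OF prob_space_attempts] distr_id2)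
    finally show "distr (attempt_space G) (\<Pi>\<^sub>M e\<in>parcs G. ?u) (\<lambda>U. \<lambda>e\<in>parcs G. U e)
        = (\<Pi>\<^sub>M e\<in>parcs G. distr (attempt_space G) ?u (\<lambda>U. U e))" .
  qed
  moreover have "measurable (attempt_space G) ?u = measurable (attempt_space G) borel"
    by (rule measurable_cong_sets) auto
  ultimately show ?thesis by (simp add: P.indep_vars_def)
qed

text \<open>Probability that one round started from the coloring \<open>C\<close> ends in a coloring from \<open>T\<close>
  (a coloring is identified with its set of blue vertices).\<close>

definition round_prob :: "'a pair_pre_digraph \<Rightarrow> 'a set \<Rightarrow> 'a set set \<Rightarrow> real" where
  "round_prob G C T =
     measure (attempt_space G) {U \<in> space (attempt_space G). pzf_round G U C \<in> T}"

text \<open>The whole process uses a fresh independent copy of the attempt space in every round: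
  \<open>\<omega> !! n\<close> is the randomness of round \<open>n + 1\<close>.\<close>

definition process_space :: "'a pair_pre_digraph \<Rightarrow> ('a \<times> 'a \<Rightarrow> real) stream measure" where
  "process_space G = stream_space (attempt_space G)"

primrec blue_after ::
  "'a pair_pre_digraph \<Rightarrow> 'a set \<Rightarrow> ('a \<times> 'a \<Rightarrow> real) stream \<Rightarrow> nat \<Rightarrow> 'a set" where
  "blue_after G B \<omega> 0 = B"
| "blue_after G B \<omega> (Suc n) = pzf_round G (\<omega> !! n) (blue_after G B \<omega> n)"

text \<open>The propagation time is \<open>\<infinity>\<close> on runs in which some vertex stays white forever.\<close>

definition pt_pzf ::
  "'a pair_pre_digraph \<Rightarrow> 'a set \<Rightarrow> ('a \<times> 'a \<Rightarrow> real) stream \<Rightarrow> enat" where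
  "pt_pzf G B \<omega> = Inf {enat n | n. blue_after G B \<omega> n = pverts G}"

text \<open>Extended-real valued, so that an equation with a real number also says that the
  expectation is finite.\<close>

definition ept :: "'a pair_pre_digraph \<Rightarrow> 'a set \<Rightarrow> ereal" where
  "ept G B = enn2ereal (\<integral>\<^sup>+ \<omega>. ennreal_of_enat (pt_pzf G B \<omega>) \<partial>process_space G)"

inductive_set simple_states :: "'a pair_pre_digraph \<Rightarrow> 'a set \<Rightarrow> 'a set set"
  for G :: "'a pair_pre_digraph" and B :: "'a set" where
  initial: "B \<in> simple_states G B"
| round: "C \<in> simple_states G B \<Longrightarrow> round_prob G C {D} > 0 \<Longrightarrow> D \<in> simple_states G B"

definition states_for :: "'a pair_pre_digraph \<Rightarrow> 'a set \<Rightarrow> 'a set set set \<Rightarrow> bool" where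
  "states_for G B P \<longleftrightarrow>
     partition_on (simple_states G B) P \<and>
     (\<forall>S\<in>P. \<forall>C\<in>S. \<forall>D\<in>S. card C = card D) \<and>
     (\<forall>S\<in>P. \<forall>T\<in>P. \<forall>C\<in>S. \<forall>D\<in>S. round_prob G C T = round_prob G D T)"

text \<open>All members of a class have equally many blue vertices and every simple state contains \<open>B\<close>,
  so the classes of \<open>B\<close> and of \<^term>\<open>pverts G\<close> are necessarily singletons.\<close>

definition ordered_state_list ::
  "'a pair_pre_digraph \<Rightarrow> 'a set \<Rightarrow> 'a set set list \<Rightarrow> bool" where
  "ordered_state_list G B Ss \<longleftrightarrow>
     Ss \<noteq> [] \<and> distinct Ss \<and> states_for G B (set Ss) \<and> hd Ss = {B} \<and> last Ss = {pverts G}"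

text \<open>The common value of \<open>round_prob G C T\<close> for the simple states \<open>C\<close> in \<open>S\<close>.\<close>

definition state_prob :: "'a pair_pre_digraph \<Rightarrow> 'a set set \<Rightarrow> 'a set set \<Rightarrow> real" where
  "state_prob G S T = (THE p. \<forall>C\<in>S. round_prob G C T = p)"

text \<open>Matrix indices start at 0, so the state \<open>S\<^sub>i\<close> has index \<open>i - 1\<close>.\<close>

definition transition_matrix :: "'a pair_pre_digraph \<Rightarrow> 'a set set list \<Rightarrow> real mat" where
  "transition_matrix G Ss =
     Matrix.mat (length Ss) (length Ss) (\<lambda>(i, j). state_prob G (Ss ! i) (Ss ! j))"

text \<open>The column vector \<open>v\<close> times the row vector \<open>w\<^sup>T\<close>.\<close>

definition outer_product :: "real Matrix.vec \<Rightarrow> real Matrix.vec \<Rightarrow> real mat" where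
  "outer_product v w = mat_of_cols (dim_vec v) [v] * mat_of_rows (dim_vec w) [w]"

end

theory Submission
  imports Defs "Jordan_Normal_Form.Determinant"
begin

text \<open>
  Let \<open>h\<close> be the expected propagation time as a function of the simple state. Conditioning on the
  first round gives \<open>h C = 1 + (\<Sum>D. p C D * h D)\<close> for \<open>C \<noteq> pverts G\<close>, and \<open>h (pverts G) = 0\<close>. If
  \<open>A = M - \<one> e\<^sup>T - I\<close> and \<open>A x = e\<close> for the last unit vector \<open>e\<close>, then the last row forces the last
  entry of \<open>x\<close> to be \<open>-1\<close>, and the other rows say that \<open>x + \<one>\<close> solves this system. Since blue sets
  only grow and, by connectedness, no nonfinal state is absorbing, a minimum principle holds; it
  yields the invertibility of \<open>A\<close>, the finiteness of \<open>h\<close> and the uniqueness of the solution.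
\<close>

section \<open>Monotonicity of the coloring and the propagation time\<close>

lemma prob_space_attempt_space: "prob_space (attempt_space G)"
  unfolding attempt_space_def by (intro prob_space_PiM prob_space_attempts)

lemma subset_pzf_round: "C \<subseteq> pzf_round G U C"
  by (auto simp: pzf_round_def)

lemma pzf_round_subset: "C \<subseteq> pverts G \<Longrightarrow> pzf_round G U C \<subseteq> pverts G"
  by (auto simp: pzf_round_def)

lemma pzf_round_pverts [simp]: "pzf_round G U (pverts G) = pverts G"
  by (auto simp: pzf_round_def)

lemma blue_after_subset: "C \<subseteq> pverts G \<Longrightarrow> blue_after G C \<omega> n \<subseteq> pverts G"
  by (induction n) (auto dest: pzf_round_subset)

lemma blue_after_Stream: "blue_after G C (U ## \<omega>) (Suc n) = blue_after G (pzf_round G U C) \<omega> n"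
  by (induction n) auto

lemma blue_after_pverts_mono:
  assumes "blue_after G C \<omega> m = pverts G" "m \<le> n"
  shows "blue_after G C \<omega> n = pverts G"
  using assms(2,1) by (induction rule: dec_induct) auto

text \<open>The all-blue coloring is absorbing, so being all blue at some time up to
  \<open>n\<close> is the same as being all blue at time \<open>n\<close>. Tail events of the
  propagation time thus become events about a single coloring.\<close>

lemma less_pt_pzf_iff: "enat n < pt_pzf G C \<omega> \<longleftrightarrow> blue_after G C \<omega> n \<noteq> pverts G"
proof -
  have "pt_pzf G C \<omega> \<le> enat n \<longleftrightarrow> (\<exists>m\<le>n. blue_after G C \<omega> m = pverts G)"
  proof
    assume le: "pt_pzf G C \<omega> \<le> enat n"
    let ?A = "{enat m |m. blue_after G C \<omega> m = pverts G}"
    have "?A \<noteq> {}"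
    proof
      assume "?A = {}"
      then have "pt_pzf G C \<omega> = \<infinity>"
        unfolding pt_pzf_def by (metis Inf_enat_def)
      with le show False by simp
    qed
    \<comment> \<open>In \<open>enat\<close> the infimum of a nonempty set is its least element,
      hence attained.\<close>
    then have "Inf ?A \<in> ?A" by (metis (mono_tags, lifting) Inf_enat_def LeastI ex_in_conv)
    with le show "\<exists>m\<le>n. blue_after G C \<omega> m = pverts G"
      by (auto simp: pt_pzf_def)
  next
    assume "\<exists>m\<le>n. blue_after G C \<omega> m = pverts G"
    then obtain m where "m \<le> n" "blue_after G C \<omega> m = pverts G" by auto
    then have "pt_pzf G C \<omega> \<le> enat m"
      unfolding pt_pzf_def by (intro Inf_lower) auto
    with \<open>m \<le> n\<close> show "pt_pzf G C \<omega> \<le> enat n" by (meson enat_ord_simps(1) order_trans)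
  qed
  with blue_after_pverts_mono show ?thesis by (metis linorder_not_less order_refl)
qed

section \<open>Measurability of the colorings\<close>

context pair_graph
begin

text \<open>The target is finite, so preimages of single colorings suffice; each is cut out by
  finitely many threshold conditions on the coordinates of \<open>U\<close>.\<close>

lemma pzf_round_measurable [measurable]:
  assumes "C \<subseteq> pverts G"
  shows "(\<lambda>U. pzf_round G U C) \<in> attempt_space G \<rightarrow>\<^sub>M count_space (Pow (pverts G))"
proof -
  have "(\<lambda>U. pzf_round G U C) -` {D} \<inter> space (attempt_space G) \<in> sets (attempt_space G)"
    if D: "D \<subseteq> pverts G" for D
  proof -
    have 1: "{U \<in> space (attempt_space G). U (u, w) \<le> force_prob G C u} \<in> sets (attempt_space G)"
      if "(u, w) \<in> parcs G" for u w
      unfolding attempt_space_def using that by measurable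
    have 2: "{U \<in> space (attempt_space G). w \<in> pzf_round G U C} \<in> sets (attempt_space G)"
      if "w \<in> pverts G" for w
    proof -
      have "{U \<in> space (attempt_space G). w \<in> pzf_round G U C} =
          (if w \<in> C then space (attempt_space G)
           else \<Union>u\<in>{u\<in>C. (u, w) \<in> parcs G}.
             {U \<in> space (attempt_space G). U (u, w) \<le> force_prob G C u})"
        using that by (auto simp: pzf_round_def neighbors_def)
      also have "\<dots> \<in> sets (attempt_space G)"
        using finite_subset[OF assms] by (auto intro!: sets.finite_UN 1)
      finally show ?thesis .
    qed
    have "(\<lambda>U. pzf_round G U C) -` {D} \<inter> space (attempt_space G) =
        {U \<in> space (attempt_space G). \<forall>w\<in>pverts G. w \<in> pzf_round G U C \<longleftrightarrow> w \<in> D}"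
    proof (rule Set.set_eqI)
      fix U
      have "pzf_round G U C = D \<longleftrightarrow> (\<forall>w\<in>pverts G. w \<in> pzf_round G U C \<longleftrightarrow> w \<in> D)"
        using D pzf_round_subset[OF assms, of U] by blast
      then show "U \<in> (\<lambda>U. pzf_round G U C) -` {D} \<inter> space (attempt_space G) \<longleftrightarrow>
          U \<in> {U \<in> space (attempt_space G). \<forall>w\<in>pverts G. w \<in> pzf_round G U C \<longleftrightarrow> w \<in> D}"
        by (simp add: conj_commute)
    qed
    also have "\<dots> \<in> sets (attempt_space G)"
    proof (rule sets.sets_Collect_finite_All)
      fix w assume "w \<in> pverts G"
      then show "{U \<in> space (attempt_space G). w \<in> pzf_round G U C \<longleftrightarrow> w \<in> D} \<in> sets (attempt_space G)"
        using 2 sets.sets_Collect_neg[OF 2] by (cases "w \<in> D") simp_all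
    qed simp
    finally show ?thesis .
  qed
  then show ?thesis
    using pzf_round_subset[OF assms] by (subst measurable_count_space_eq2) auto
qed

text \<open>Only finitely many colorings can precede a round. For each fixed one the next coloring
  is a measurable function of \<open>\<omega> !! n\<close>, and these pieces are glued.\<close>

lemma blue_after_measurable [measurable]:
  assumes "C \<subseteq> pverts G"
  shows "(\<lambda>\<omega>. blue_after G C \<omega> n) \<in> process_space G \<rightarrow>\<^sub>M count_space (Pow (pverts G))"
proof (induction n)
  case 0
  show ?case using assms by simp
next
  case (Suc n)
  have "(\<lambda>\<omega>. pzf_round G (\<omega> !! n) D) \<in> process_space G \<rightarrow>\<^sub>M count_space (Pow (pverts G))"
    if "D \<in> Pow (pverts G)" for D
    using that unfolding process_space_def
    by (intro measurable_compose[OF measurable_snth pzf_round_measurable]) auto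
  from measurable_compose_countable'[OF this Suc] show ?case
    by (simp add: countable_finite)
qed

section \<open>One-round transition probabilities\<close>

lemma round_measurable_set:
  assumes "C \<subseteq> pverts G"
  shows "{U \<in> space (attempt_space G). pzf_round G U C \<in> T} \<in> sets (attempt_space G)"
proof -
  have "{U \<in> space (attempt_space G). pzf_round G U C \<in> T} =
      (\<lambda>U. pzf_round G U C) -` (T \<inter> Pow (pverts G)) \<inter> space (attempt_space G)"
    using pzf_round_subset[OF assms] by auto
  also have "\<dots> \<in> sets (attempt_space G)"
    by (rule measurable_sets[OF pzf_round_measurable[OF assms]]) auto
  finally show ?thesis .
qed

text \<open>Splitting the space by the resulting coloring turns expectations over one round into
  finite sums, the form in which the first round is conditioned on later.\<close>

lemma integral_pzf_round:
  fixes g :: "'a set \<Rightarrow> real"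
  assumes "C \<subseteq> pverts G"
  shows "(\<integral>U. g (pzf_round G U C) \<partial>attempt_space G) =
    (\<Sum>D\<in>Pow (pverts G). round_prob G C {D} * g D)"
proof -
  interpret P: prob_space "attempt_space G" by (rule prob_space_attempt_space)
  let ?E = "\<lambda>D. {U \<in> space (attempt_space G). pzf_round G U C \<in> {D}}"
  have "(\<integral>U. g (pzf_round G U C) \<partial>attempt_space G) =
      (\<integral>U. (\<Sum>D\<in>Pow (pverts G). indicator (?E D) U * g D) \<partial>attempt_space G)"
  proof (rule Bochner_Integration.integral_cong)
    fix U assume U: "U \<in> space (attempt_space G)"
    have "(\<Sum>D\<in>Pow (pverts G). indicator (?E D) U * g D) =
        (\<Sum>D\<in>Pow (pverts G). if pzf_round G U C = D then g D else 0)"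
      using U by (intro sum.cong) (auto simp: indicator_def)
    also have "\<dots> = g (pzf_round G U C)"
      using pzf_round_subset[OF assms] by simp
    finally show "g (pzf_round G U C) = (\<Sum>D\<in>Pow (pverts G). indicator (?E D) U * g D)" ..
  qed simp
  also have "\<dots> = (\<Sum>D\<in>Pow (pverts G). \<integral>U. indicator (?E D) U * g D \<partial>attempt_space G)"
    using round_measurable_set[OF assms, of "{D}" for D, simplified]
    by (intro Bochner_Integration.integral_sum integrable_mult_left integrable_real_indicator)
      (auto simp: P.emeasure_eq_measure)
  also have "\<dots> = (\<Sum>D\<in>Pow (pverts G). round_prob G C {D} * g D)"
    using round_measurable_set[OF assms, of "{D}" for D, simplified]
    by (intro sum.cong refl) (simp add: round_prob_def Int_def cong: conj_cong)
  finally show ?thesis .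
qed

lemma round_prob_eq_sum:
  assumes "C \<subseteq> pverts G"
  shows "round_prob G C T = (\<Sum>D\<in>T \<inter> Pow (pverts G). round_prob G C {D})"
proof -
  have "round_prob G C T = (\<integral>U. indicator T (pzf_round G U C) \<partial>attempt_space G)"
    using round_measurable_set[OF assms, of T]
    by (subst Bochner_Integration.integral_cong
        [where g = "indicator {U \<in> space (attempt_space G). pzf_round G U C \<in> T}", OF refl])
      (auto simp: indicator_def round_prob_def Int_def cong: conj_cong)
  also have "\<dots> = (\<Sum>D\<in>Pow (pverts G). round_prob G C {D} * indicator T D)"
    by (rule integral_pzf_round[OF assms])
  also have "\<dots> = (\<Sum>D\<in>T \<inter> Pow (pverts G). round_prob G C {D})"
    by (rule sum.mono_neutral_cong_right) (auto simp: indicator_def)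
  finally show ?thesis .
qed

lemma sum_round_prob:
  assumes "C \<subseteq> pverts G"
  shows "(\<Sum>D\<in>Pow (pverts G). round_prob G C {D}) = 1"
proof -
  interpret P: prob_space "attempt_space G" by (rule prob_space_attempt_space)
  show ?thesis using integral_pzf_round[OF assms, of "\<lambda>_. 1"] by (simp add: P.prob_space)
qed

lemma round_prob_nonneg: "0 \<le> round_prob G C T"
  by (simp add: round_prob_def)

lemma round_prob_nonzero_imp_subset:
  assumes "round_prob G C {D} \<noteq> 0" shows "C \<subseteq> D"
proof (rule ccontr)
  assume "\<not> C \<subseteq> D"
  then have "{U \<in> space (attempt_space G). pzf_round G U C \<in> {D}} = {}"
    using subset_pzf_round[of C G] by blast
  with assms show False by (simp only: round_prob_def measure_empty)
qed

text \<open>Without such an arc \<open>C\<close> would be closed under reachability and, by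
  connectedness, contain every vertex.\<close>

lemma crossing_arc:
  assumes con: "Digraph_Component.connected (with_proj G)"
    and C: "C \<subseteq> pverts G" "C \<noteq> {}" "C \<noteq> pverts G"
  obtains u w where "(u, w) \<in> parcs G" "u \<in> C" "w \<notin> C"
proof (rule ccontr)
  assume no: "\<not> thesis"
  obtain a b where a: "a \<in> C" and b: "b \<in> pverts G" "b \<notin> C" using C by auto
  have "a \<rightarrow>\<^sup>*\<^bsub>mk_symmetric (with_proj G)\<^esub> b"
    using con a b C
    by (auto simp: Digraph_Component.connected_def strongly_connected_def)
  \<comment> \<open>Connectedness is defined through the symmetric closure; the arcs are already
    symmetric, so nothing is added.\<close>
  then have "a \<rightarrow>\<^sup>*\<^bsub>with_proj G\<^esub> b"
    by (simp add: reachable_mk_symmetric_eq sym_arcs)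
  then have "b \<in> C"
  proof (induction rule: reachable_induct)
    case base show ?case by (rule a)
  next
    case (step x y)
    then show ?case using no that by (auto simp: arcs_ends_conv)
  qed
  with b show False by simp
qed

text \<open>Forcing across an arc that leaves \<open>C\<close> succeeds with positive probability,
  and success changes the coloring.\<close>

lemma round_prob_stay_less_1:
  assumes con: "Digraph_Component.connected (with_proj G)"
    and C: "C \<subseteq> pverts G" "C \<noteq> {}" "C \<noteq> pverts G"
  shows "round_prob G C {C} < 1"
proof -
  interpret P: prob_space "attempt_space G" by (rule prob_space_attempt_space)
  obtain u w where uw: "(u, w) \<in> parcs G" "u \<in> C" "w \<notin> C"
    using crossing_arc[OF con C] .
  then have w: "w \<in> neighbors G u" "w \<in> pverts G"
    using in_arcsD2 by (auto simp: neighbors_def)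
  let ?p = "force_prob G C u"
  let ?F = "{U \<in> space (attempt_space G). U (u, w) \<le> ?p}"
  let ?E = "{U \<in> space (attempt_space G). pzf_round G U C \<in> {C}}"
  have p: "0 < ?p" "?p \<le> 1"
    using force_prob_bounds[OF _ uw(2) w(1) uw(3)] pair_graph_axioms by auto
  have F: "?F \<in> sets (attempt_space G)"
    unfolding attempt_space_def using uw(1) by measurable
  have "?E \<inter> ?F = {}"
    using uw w by (auto simp: pzf_round_def)
  then have "P.prob ?E + P.prob ?F = P.prob (?E \<union> ?F)"
    using round_measurable_set[OF C(1), of "{C}", simplified] F by (subst P.finite_measure_Union) auto
  also have "\<dots> \<le> 1" by simp
  finally show ?thesis
    using p prob_attempt[OF uw(1), of ?p] by (simp only: round_prob_def)
qed

section \<open>Tail probabilities of the propagation time\<close>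

definition white_prob :: "'a set \<Rightarrow> nat \<Rightarrow> real" where
  "white_prob C n =
    measure (process_space G) {\<omega> \<in> space (process_space G). blue_after G C \<omega> n \<noteq> pverts G}"

lemma white_prob_nonneg: "0 \<le> white_prob C n"
  by (simp add: white_prob_def)

lemma white_event_measurable:
  assumes "C \<subseteq> pverts G"
  shows "{\<omega> \<in> space (process_space G). blue_after G C \<omega> n \<noteq> pverts G} \<in> sets (process_space G)"
proof -
  have "{\<omega> \<in> space (process_space G). blue_after G C \<omega> n \<noteq> pverts G} =
      (\<lambda>\<omega>. blue_after G C \<omega> n) -` (Pow (pverts G) - {pverts G}) \<inter> space (process_space G)"
    using blue_after_subset[OF assms] by auto
  also have "\<dots> \<in> sets (process_space G)"
    by (rule measurable_sets[OF blue_after_measurable[OF assms]]) auto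
  finally show ?thesis .
qed

lemma white_prob_0: "white_prob C 0 = (if C = pverts G then 0 else 1)"
proof -
  interpret S: prob_space "process_space G"
    unfolding process_space_def
    by (intro prob_space.prob_space_stream_space prob_space_attempt_space)
  show ?thesis by (simp add: white_prob_def S.prob_space)
qed

text \<open>Conditioning on the first round: the tail of the stream drives a fresh copy of the
  process, started from the coloring that this round produced.\<close>

lemma white_prob_Suc:
  assumes "C \<subseteq> pverts G"
  shows "white_prob C (Suc n) = (\<Sum>D\<in>Pow (pverts G). round_prob G C {D} * white_prob D n)"
proof -
  interpret P: prob_space "attempt_space G" by (rule prob_space_attempt_space)
  interpret S: prob_space "process_space G"
    unfolding process_space_def by (rule P.prob_space_stream_space)
  have "ennreal (white_prob C (Suc n)) =
      (\<integral>\<^sup>+U. ennreal (white_prob (pzf_round G U C) n) \<partial>attempt_space G)"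
    using P.prob_stream_space[of "\<lambda>\<omega>. blue_after G C \<omega> (Suc n) \<noteq> pverts G"]
      white_event_measurable[OF assms, of "Suc n"]
    unfolding white_prob_def process_space_def blue_after_Stream by auto
  also have "\<dots> = ennreal (\<integral>U. white_prob (pzf_round G U C) n \<partial>attempt_space G)"
  proof (rule nn_integral_eq_integral)
    have "(\<lambda>U. white_prob (pzf_round G U C) n) \<in> borel_measurable (attempt_space G)"
      by (rule measurable_compose[OF pzf_round_measurable[OF assms]]) simp
    then show "integrable (attempt_space G) (\<lambda>U. white_prob (pzf_round G U C) n)"
      by (rule P.integrable_const_bound[where B = 1, rotated])
        (auto simp: white_prob_def)
  qed (simp add: white_prob_nonneg)
  also have "\<dots> = ennreal (\<Sum>D\<in>Pow (pverts G). round_prob G C {D} * white_prob D n)"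
    by (simp add: integral_pzf_round[OF assms, of "\<lambda>D. white_prob D n"])
  finally show ?thesis
    by (simp add: white_prob_nonneg round_prob_nonneg sum_nonneg)
qed

text \<open>Reduces equality in \<open>enat\<close> to countably many comparisons, so that
  measurable tail events make \<open>pt_pzf\<close> measurable.\<close>

lemma enat_eq_iff_less: "a = b \<longleftrightarrow> (\<forall>n. enat n < a \<longleftrightarrow> enat n < b)"
proof
  assume *: "\<forall>n. enat n < a \<longleftrightarrow> enat n < b"
  have "\<not> a < b" using * by (cases a) auto
  moreover have "\<not> b < a" using * by (cases b) auto
  ultimately show "a = b" by simp
qed simp

lemma pt_pzf_measurable:
  assumes "C \<subseteq> pverts G"
  shows "pt_pzf G C \<in> process_space G \<rightarrow>\<^sub>M count_space UNIV"
proof (subst measurable_count_space_eq_countable, safe)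
  have less [measurable]: "Measurable.pred (process_space G) (\<lambda>\<omega>. enat n < pt_pzf G C \<omega>)" for n
    using white_event_measurable[OF assms, of n] by (simp add: less_pt_pzf_iff pred_def)
  fix x :: enat
  have "Measurable.pred (process_space G) (\<lambda>\<omega>. pt_pzf G C \<omega> = x)"
    unfolding enat_eq_iff_less[of _ x] by measurable
  then show "pt_pzf G C -` {x} \<inter> space (process_space G) \<in> sets (process_space G)"
    by (simp add: pred_def vimage_def Int_def conj_commute)
qed auto

text \<open>Tail-sum formula for the expectation of an \<open>enat\<close>-valued variable, with the
  tails supplied by \<open>less_pt_pzf_iff\<close>. Summability makes the value a finite
  real.\<close>

lemma ept_eq_suminf:
  assumes "C \<subseteq> pverts G" "summable (white_prob C)"
  shows "ept G C = ereal (\<Sum>n. white_prob C n)"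
proof -
  interpret S: prob_space "process_space G"
    unfolding process_space_def
    by (intro prob_space.prob_space_stream_space prob_space_attempt_space)
  have "(\<integral>\<^sup>+ \<omega>. ennreal_of_enat (pt_pzf G C \<omega>) \<partial>process_space G) =
      (\<Sum>n. ennreal (white_prob C n))"
    by (simp add: nn_integral_enat_function pt_pzf_measurable[OF assms(1)] less_pt_pzf_iff
        S.emeasure_eq_measure white_prob_def)
  also have "\<dots> = ennreal (\<Sum>n. white_prob C n)"
    by (intro suminf_ennreal_eq summable_sums assms white_prob_nonneg)
  finally show ?thesis
    by (simp add: ept_def enn2ereal_ennreal suminf_nonneg assms white_prob_nonneg)
qed

section \<open>Simple states and the minimum principle\<close>

lemma round_prob_nonzero_imp_pverts:
  assumes "C \<subseteq> pverts G" "round_prob G C {D} \<noteq> 0" shows "D \<subseteq> pverts G"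
proof (rule ccontr)
  assume "\<not> D \<subseteq> pverts G"
  then have "{U \<in> space (attempt_space G). pzf_round G U C \<in> {D}} = {}"
    using pzf_round_subset[OF assms(1)] by blast
  with assms show False by (simp only: round_prob_def measure_empty)
qed

lemma round_prob_pverts: "round_prob G (pverts G) {D} = (if D = pverts G then 1 else 0)"
proof -
  interpret P: prob_space "attempt_space G" by (rule prob_space_attempt_space)
  show ?thesis by (simp add: round_prob_def P.prob_space)
qed

lemma white_prob_pverts: "white_prob (pverts G) n = 0"
proof -
  have "blue_after G (pverts G) \<omega> n = pverts G" for \<omega>
    by (rule blue_after_pverts_mono[of _ _ _ 0]) simp_all
  then show ?thesis by (simp add: white_prob_def)
qed

lemma simple_states_bounds:
  assumes "B \<subseteq> pverts G" "C \<in> simple_states G B"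
  shows "B \<subseteq> C" "C \<subseteq> pverts G"
proof -
  from assms(2) have "B \<subseteq> C \<and> C \<subseteq> pverts G"
  proof induction
    case initial
    then show ?case using assms(1) by simp
  next
    case (round C D)
    then show ?case
      using round_prob_nonzero_imp_subset[of C D] round_prob_nonzero_imp_pverts[of C D] by auto
  qed
  then show "B \<subseteq> C" "C \<subseteq> pverts G" by auto
qed

text \<open>Read contrapositively: from a simple state, colorings that are not simple states have
  weight zero, so sums over \<open>Pow (pverts G)\<close> act as sums over simple states.\<close>

lemma simple_states_step:
  assumes "C \<in> simple_states G B" "round_prob G C {D} \<noteq> 0"
  shows "D \<in> simple_states G B"
  using round_prob_nonneg[of C "{D}"] assms(2) by (intro simple_states.round[OF assms(1)]) simp

text \<open>Blue sets only grow, so one argues by induction on the number of white vertices; the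
  coefficient of \<open>f C\<close> in the inequality for \<open>C\<close> is \<open>1 - round_prob G C {C} > 0\<close>.\<close>

lemma minimum_principle:
  fixes f :: "'a set \<Rightarrow> real"
  assumes con: "Digraph_Component.connected (with_proj G)"
    and B: "B \<subseteq> pverts G" "B \<noteq> {}"
    and final: "0 \<le> f (pverts G)"
    and super: "\<And>C. C \<in> simple_states G B \<Longrightarrow> C \<noteq> pverts G \<Longrightarrow>
      (\<Sum>D\<in>Pow (pverts G). round_prob G C {D} * f D) \<le> f C"
    and C: "C \<in> simple_states G B"
  shows "0 \<le> f C"
  using C
proof (induction "card (pverts G - C)" arbitrary: C rule: less_induct)
  case less
  show ?case
  proof (cases "C = pverts G")
    case True
    then show ?thesis using final by simp
  next
    case False
    have C: "C \<subseteq> pverts G" "C \<noteq> {}"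
      using simple_states_bounds[OF B(1) less.prems] B by auto
    \<comment> \<open>A term of nonzero weight belongs to a strictly larger blue set, where the
      induction hypothesis applies.\<close>
    have nonneg: "0 \<le> round_prob G C {D} * f D" if D: "D \<in> Pow (pverts G) - {C}" for D
    proof (cases "round_prob G C {D} = 0")
      case nz: False
      have "C \<subset> D" using D round_prob_nonzero_imp_subset[OF nz] by auto
      then have "card (pverts G - D) < card (pverts G - C)"
        using D by (intro psubset_card_mono) auto
      then have "0 \<le> f D"
        by (rule less.hyps) (rule simple_states_step[OF less.prems nz])
      then show ?thesis by (simp add: round_prob_nonneg)
    qed simp
    have "round_prob G C {C} * f C \<le>
        round_prob G C {C} * f C + (\<Sum>D\<in>Pow (pverts G) - {C}. round_prob G C {D} * f D)"
      using sum_nonneg[of "Pow (pverts G) - {C}", OF nonneg] by simp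
    also have "\<dots> = (\<Sum>D\<in>Pow (pverts G). round_prob G C {D} * f D)"
      using C by (subst sum.remove[of _ C]) auto
    also have "\<dots> \<le> f C" by (rule super[OF less.prems False])
    finally have "0 \<le> (1 - round_prob G C {C}) * f C" by (simp add: algebra_simps)
    then show ?thesis
      using round_prob_stay_less_1[OF con C False] by (simp add: zero_le_mult_iff)
  qed
qed

text \<open>The minimum principle applies both to \<open>f\<close> and to
  \<open>- f\<close>.\<close>

lemma harmonic_eq_0:
  fixes f :: "'a set \<Rightarrow> real"
  assumes "Digraph_Component.connected (with_proj G)"
    and "B \<subseteq> pverts G" "B \<noteq> {}"
    and "f (pverts G) = 0"
    and "\<And>C. C \<in> simple_states G B \<Longrightarrow> C \<noteq> pverts G \<Longrightarrow>
      f C = (\<Sum>D\<in>Pow (pverts G). round_prob G C {D} * f D)"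
    and "C \<in> simple_states G B"
  shows "f C = 0"
proof -
  have "0 \<le> f C"
    by (rule minimum_principle[OF assms(1-3)]) (simp_all add: assms(4,6) flip: assms(5))
  moreover have "0 \<le> - f C"
    by (rule minimum_principle[OF assms(1-3)])
      (simp_all add: assms(4,6) sum_negf flip: assms(5))
  ultimately show ?thesis by simp
qed

text \<open>The partial sums of \<open>white_prob C\<close> satisfy the truncated recursion and hence stay below any
  nonnegative solution \<open>H\<close> of the full one. This gives convergence, and the limit equals \<open>H\<close>
  since the difference of the two is harmonic.\<close>

lemma white_prob_sums_hitting_time:
  fixes H :: "'a set \<Rightarrow> real"
  assumes con: "Digraph_Component.connected (with_proj G)"
    and B: "B \<subseteq> pverts G" "B \<noteq> {}"
    and final: "H (pverts G) = 0"
    and rec: "\<And>C. C \<in> simple_states G B \<Longrightarrow> C \<noteq> pverts G \<Longrightarrow>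
      H C = 1 + (\<Sum>D\<in>Pow (pverts G). round_prob G C {D} * H D)"
    and C: "C \<in> simple_states G B"
  shows "white_prob C sums H C"
proof -
  have "(\<Sum>k<n. white_prob C k) \<le> H C" if "C \<in> simple_states G B" for C n
    using that
  proof (induction n arbitrary: C)
    case 0
    have "0 \<le> H C"
      by (rule minimum_principle[OF con B _ _ 0]) (simp_all add: final rec)
    then show ?case by simp
  next
    case (Suc n)
    show ?case
    proof (cases "C = pverts G")
      case True
      then show ?thesis by (simp add: white_prob_pverts final)
    next
      case False
      have C: "C \<subseteq> pverts G" by (rule simple_states_bounds[OF B(1) Suc.prems])
      \<comment> \<open>The term for \<open>k = 0\<close> equals 1 because \<open>C\<close> still
        has a white vertex.\<close>
      have "(\<Sum>k<Suc n. white_prob C k) = 1 + (\<Sum>k<n. white_prob C (Suc k))"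
        by (subst sum.lessThan_Suc_shift) (simp add: white_prob_0 False)
      also have "(\<Sum>k<n. white_prob C (Suc k)) =
          (\<Sum>D\<in>Pow (pverts G). round_prob G C {D} * (\<Sum>k<n. white_prob D k))"
        by (subst sum_distrib_left, subst sum.swap) (simp add: white_prob_Suc[OF C])
      also have "\<dots> \<le> (\<Sum>D\<in>Pow (pverts G). round_prob G C {D} * H D)"
      proof (rule sum_mono)
        fix D
        \<comment> \<open>The induction hypothesis covers simple states only; any other
          \<open>D\<close> has weight zero.\<close>
        show "round_prob G C {D} * (\<Sum>k<n. white_prob D k) \<le> round_prob G C {D} * H D"
          using Suc.IH[OF simple_states_step[OF Suc.prems, of D]]
          by (cases "round_prob G C {D} = 0") (auto intro: mult_left_mono simp: round_prob_nonneg)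
      qed
      finally show ?thesis by (simp add: rec[OF Suc.prems False])
    qed
  qed
  then have summable: "summable (white_prob C)" if "C \<in> simple_states G B" for C
    using that white_prob_nonneg by (intro summableI_nonneg_bounded) auto
  let ?h = "\<lambda>C. \<Sum>n. white_prob C n"
  have h: "?h C = 1 + (\<Sum>D\<in>Pow (pverts G). round_prob G C {D} * ?h D)"
    if X: "C \<in> simple_states G B" and "C \<noteq> pverts G" for C
  proof -
    have C: "C \<subseteq> pverts G" by (rule simple_states_bounds[OF B(1) X])
    have "(\<lambda>n. round_prob G C {D} * white_prob D n) sums (round_prob G C {D} * ?h D)" for D
      using summable[OF simple_states_step[OF X, of D]]
      by (cases "round_prob G C {D} = 0") (auto intro: sums_mult summable_sums)
    then have "(\<lambda>n. white_prob C (Suc n)) sums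
        (\<Sum>D\<in>Pow (pverts G). round_prob G C {D} * ?h D)"
      unfolding white_prob_Suc[OF C] by (intro sums_sum)
    then show ?thesis
      using suminf_split_head[OF summable[OF X]] that by (simp add: white_prob_0 flip: sums_unique)
  qed
  \<comment> \<open>The constants 1 of the two recursions cancel, so the difference is harmonic and
    vanishes at \<open>pverts G\<close>.\<close>
  have "?h C - H C = 0"
    by (rule harmonic_eq_0[OF con B _ _ C])
      (simp_all add: white_prob_pverts final h rec right_diff_distrib sum_subtractf)
  then show ?thesis using summable_sums[OF summable[OF C]] by simp
qed

end

section \<open>Linear algebra of the shifted matrix\<close>

lemma mat_inverse_eq_SomeI:
  fixes A :: "'b::field mat"
  assumes A: "A \<in> carrier_mat n n"
    and ker: "\<And>v. v \<in> carrier_vec n \<Longrightarrow> A *\<^sub>v v = 0\<^sub>v n \<Longrightarrow> v = 0\<^sub>v n"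
  obtains N where "mat_inverse A = Some N" "N \<in> carrier_mat n n" "A * N = 1\<^sub>m n"
proof -
  \<comment> \<open>A trivial kernel excludes determinant zero; the matrix is then a unit and
    \<open>mat_inverse\<close> cannot return \<open>None\<close>.\<close>
  have "Determinant.det A \<noteq> 0"
    using ker det_0_iff_vec_prod_zero_field[OF A] by auto
  then have "mat_inverse A \<noteq> None"
    using mat_inverse(1)[OF A, of "()"] det_non_zero_imp_unit[OF A, of "()"] by blast
  then show thesis using mat_inverse(2)[OF A] that by auto
qed

text \<open>The rank-one term sends \<open>v\<close> to a constant vector whose entries are the
  \<open>k\<close>-th entry of \<open>v\<close>, hence the same subtracted term in every
  row.\<close>

lemma shifted_mult_vec_index:
  assumes M: "M \<in> carrier_mat s s" and v: "v \<in> carrier_vec s" and i: "i < s" and "k < s"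
  shows "vec_index ((M - outer_product (Matrix.vec s (\<lambda>_. 1)) (unit_vec s k) - 1\<^sub>m s) *\<^sub>v v) i =
    (\<Sum>j<s. M $$ (i, j) * vec_index v j) - vec_index v k - vec_index v i"
proof -
  let ?O = "outer_product (Matrix.vec s (\<lambda>_. 1)) (unit_vec s k)"
  have dims: "dim_row ?O = s" "dim_col ?O = s"
    by (simp_all add: outer_product_def)
  have entry: "(M - ?O - 1\<^sub>m s) $$ (i, j) =
      M $$ (i, j) - (if j = k then 1 else 0) - (if j = i then 1 else 0)" if j: "j < s" for j
  proof -
    have "?O $$ (i, j) = (if j = k then 1 else 0)"
      using i j \<open>k < s\<close>
      by (simp add: outer_product_def scalar_prod_def mat_of_cols_def mat_of_rows_def)
    then show ?thesis using M i j dims by auto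
  qed
  have "vec_index ((M - ?O - 1\<^sub>m s) *\<^sub>v v) i =
      (\<Sum>j<s. (M - ?O - 1\<^sub>m s) $$ (i, j) * vec_index v j)"
    using M v i dims by (simp add: scalar_prod_def atLeast0LessThan)
  also have "\<dots> =
      (\<Sum>j<s. (M $$ (i, j) - (if j = k then 1 else 0) - (if j = i then 1 else 0)) * vec_index v j)"
    by (intro sum.cong) (simp_all only: entry lessThan_iff)
  also have "\<dots> = (\<Sum>j<s. M $$ (i, j) * vec_index v j - (if j = k then vec_index v j else 0)
      - (if j = i then vec_index v j else 0))"
    by (intro sum.cong) (auto simp: algebra_simps)
  also have "\<dots> = (\<Sum>j<s. M $$ (i, j) * vec_index v j) - vec_index v k - vec_index v i"
    using i \<open>k < s\<close> by (simp add: sum_subtractf)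
  finally show ?thesis .
qed

section \<open>States as classes of simple states\<close>

definition state_index :: "'a set set list \<Rightarrow> 'a set \<Rightarrow> nat" where
  "state_index Ss C = (LEAST i. C \<in> Ss ! i)"

text \<open>Equal one-round probabilities within a class make the definite description well defined;
  the member \<open>C\<close> gives uniqueness.\<close>

lemma state_prob_eq:
  assumes "states_for G B P" "S \<in> P" "T \<in> P" "C \<in> S"
  shows "state_prob G S T = round_prob G C T"
  unfolding state_prob_def
proof (rule the_equality)
  have "\<forall>S\<in>P. \<forall>T\<in>P. \<forall>C\<in>S. \<forall>D\<in>S. round_prob G C T = round_prob G D T"
    using assms(1)[unfolded states_for_def] by (elim conjE)
  from this[rule_format, OF assms(2,3) _ assms(4)]
  show "\<forall>D\<in>S. round_prob G D T = round_prob G C T" by (rule ballI)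
  show "p = round_prob G C T" if "\<forall>D\<in>S. round_prob G D T = p" for p
    using that assms(4) by simp
qed

context
  fixes G :: "'a pair_pre_digraph" and B :: "'a set" and Ss :: "'a set set list"
  assumes states: "ordered_state_list G B Ss"
begin

lemma states_for_set: "states_for G B (set Ss)"
  using states by (simp only: ordered_state_list_def)

lemma partition_states: "partition_on (simple_states G B) (set Ss)"
  using states_for_set[unfolded states_for_def] by (elim conjE)

lemma nth_states_disjoint:
  assumes "i < length Ss" "j < length Ss" "C \<in> Ss ! i" "C \<in> Ss ! j"
  shows "i = j"
proof -
  have "Ss ! i = Ss ! j"
    using disjointD[OF partition_onD2[OF partition_states]] assms nth_mem by (metis IntI empty_iff)
  then show ?thesis
    using assms states by (simp add: ordered_state_list_def nth_eq_iff_index_eq)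
qed

lemma Union_nth_states: "(\<Union>i<length Ss. Ss ! i) = simple_states G B"
  using partition_onD1[OF partition_states] by (auto simp: set_conv_nth)

lemma state_index_eq:
  assumes i: "i < length Ss" "C \<in> Ss ! i"
  shows "state_index Ss C = i"
  unfolding state_index_def
proof (rule Least_equality)
  \<comment> \<open>\<open>LEAST\<close> ranges over all natural numbers. Beyond the list
    \<open>Ss ! j\<close> is unspecified, but such \<open>j\<close> exceed \<open>i\<close>
    anyway.\<close>
  fix j assume "C \<in> Ss ! j"
  then show "i \<le> j"
    using nth_states_disjoint[OF i(1) _ i(2), of j] i(1) by (cases "j < length Ss") auto
qed (rule i)

lemma simple_state_in_nth:
  assumes "C \<in> simple_states G B"
  obtains i where "i < length Ss" "C \<in> Ss ! i"
  using assms Union_nth_states by auto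

lemma pverts_last_state: "0 < length Ss" "pverts G \<in> Ss ! (length Ss - 1)"
  using states by (auto simp: ordered_state_list_def last_conv_nth)

lemma initial_first_state: "B \<in> Ss ! 0"
  using states by (auto simp: ordered_state_list_def hd_conv_nth)

text \<open>A vector indexed by the states is lifted to the simple states, where the rows of the
  transition matrix act by the one-round probabilities.\<close>

lemma transition_matrix_row:
  assumes "pair_graph G" and B: "B \<subseteq> pverts G" and C: "C \<in> simple_states G B"
  shows "(\<Sum>j<length Ss. transition_matrix G Ss $$ (state_index Ss C, j) * x j) =
    (\<Sum>D\<in>Pow (pverts G). round_prob G C {D} * x (state_index Ss D))"
proof -
  interpret pair_graph G by fact
  obtain i where i: "i < length Ss" "C \<in> Ss ! i" using simple_state_in_nth[OF C] .
  have C': "C \<subseteq> pverts G" using simple_states_bounds[OF B C] by simp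
  have sub: "Ss ! j \<subseteq> Pow (pverts G)" if "j < length Ss" for j
    using that Union_nth_states simple_states_bounds[OF B] by blast
  have "transition_matrix G Ss $$ (i, j) * x j =
      (\<Sum>D\<in>Ss ! j. round_prob G C {D} * x (state_index Ss D))" if j: "j < length Ss" for j
  proof -
    have "transition_matrix G Ss $$ (i, j) = round_prob G C (Ss ! j)"
      using i j state_prob_eq[OF states_for_set] by (simp add: transition_matrix_def)
    also have "\<dots> = (\<Sum>D\<in>Ss ! j. round_prob G C {D})"
      using round_prob_eq_sum[OF C', of "Ss ! j"] sub[OF j] by (simp add: Int_absorb2)
    finally show ?thesis
      using j by (auto simp: sum_distrib_right state_index_eq intro!: sum.cong)
  qed
  then have "(\<Sum>j<length Ss. transition_matrix G Ss $$ (i, j) * x j) =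
      (\<Sum>j<length Ss. \<Sum>D\<in>Ss ! j. round_prob G C {D} * x (state_index Ss D))"
    by simp
  also have "\<dots> = (\<Sum>D\<in>(\<Union>j<length Ss. Ss ! j). round_prob G C {D} * x (state_index Ss D))"
    using sub nth_states_disjoint
    by (intro sum.UNION_disjoint[symmetric]) (auto intro: finite_subset[OF sub])
  \<comment> \<open>Sets that are not simple states have weight zero, whatever value
    \<open>state_index\<close> takes on them.\<close>
  also have "\<dots> = (\<Sum>D\<in>Pow (pverts G). round_prob G C {D} * x (state_index Ss D))"
    unfolding Union_nth_states
  proof (intro sum.mono_neutral_left ballI)
    fix D assume "D \<in> Pow (pverts G) - simple_states G B"
    then have "round_prob G C {D} = 0" using simple_states_step[OF C] by blast
    then show "round_prob G C {D} * x (state_index Ss D) = 0" by simp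
  qed (use simple_states_bounds[OF B] in auto)
  finally show ?thesis using state_index_eq[OF i] by simp
qed

end

theorem theorem2p2:
  fixes G :: "'a pair_pre_digraph" and B :: "'a set" and Ss :: "'a set set list"
  fixes s :: nat and M :: "real mat"
  assumes "pair_graph G" and "Digraph_Component.connected (with_proj G)"
    and "B \<subseteq> pverts G" and "B \<noteq> {}"
    and "ordered_state_list G B Ss" and "s = length Ss"
    and "M = transition_matrix G Ss"
  shows "\<exists>N. mat_inverse (M - outer_product (Matrix.vec s (\<lambda>_. 1)) (unit_vec s (s - 1)) - 1\<^sub>m s) = Some N
           \<and> ept G B = ereal (N $$ (0, s - 1) + 1)"
proof -

  \<comment> \<open>Invertibility, and the expected time from the last column of the inverse\<close>
  interpret pair_graph G by fact
  note con = assms(2) and B = assms(3,4) and states = assms(5)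
  let ?A = "M - outer_product (Matrix.vec s (\<lambda>_. 1)) (unit_vec s (s - 1)) - 1\<^sub>m s"
  let ?idx = "state_index Ss"
  have s: "0 < s" "s - 1 < s" using pverts_last_state(1)[OF states] assms(6) by auto
  have M: "M \<in> carrier_mat s s" by (simp add: assms(6,7) transition_matrix_def)
  have A: "?A \<in> carrier_mat s s" by auto
  have idx_last: "?idx (pverts G) = s - 1"
    using state_index_eq[OF states] pverts_last_state[OF states] assms(6) by simp
  have idx: "?idx C < s" if "C \<in> simple_states G B" for C
    using simple_state_in_nth[OF states that] state_index_eq[OF states] assms(6) by metis
  have row: "vec_index (?A *\<^sub>v v) (?idx C) =
      (\<Sum>D\<in>Pow (pverts G). round_prob G C {D} * vec_index v (?idx D))
        - vec_index v (s - 1) - vec_index v (?idx C)"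
    if "v \<in> carrier_vec s" "C \<in> simple_states G B" for v C
    using shifted_mult_vec_index[OF M that(1) idx[OF that(2)] s(2)]
      transition_matrix_row[OF states assms(1) B(1) that(2), of "vec_index v"] assms(6,7)
    by simp
  have final: "pverts G \<in> simple_states G B"
    using Union_nth_states[OF states] pverts_last_state[OF states] by auto
  \<comment> \<open>The final state is absorbing, so its row of \<open>M\<close> returns the last
    entry of \<open>v\<close>; of the two subtracted copies one remains.\<close>
  have row_last: "vec_index (?A *\<^sub>v v) (s - 1) = - vec_index v (s - 1)"
    if "v \<in> carrier_vec s" for v
    using row[OF that final] by (simp add: round_prob_pverts idx_last if_distrib if_distribR
        sum.delta cong: if_cong)
  \<comment> \<open>A kernel vector has last entry 0, so its lift to the simple states is harmonic
    and vanishes at \<open>pverts G\<close>.\<close>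
  have ker: "v = 0\<^sub>v s" if v: "v \<in> carrier_vec s" and 0: "?A *\<^sub>v v = 0\<^sub>v s" for v
  proof (rule eq_vecI)
    have last: "vec_index v (s - 1) = 0" using row_last[OF v, unfolded 0] s(2) by simp
    have harmonic: "vec_index v (?idx C) = 0" if C: "C \<in> simple_states G B" for C
    proof (rule harmonic_eq_0[OF con B _ _ C])
      fix C assume C: "C \<in> simple_states G B"
      show "vec_index v (?idx C) =
          (\<Sum>D\<in>Pow (pverts G). round_prob G C {D} * vec_index v (?idx D))"
        using row[OF v C, unfolded 0] idx[OF C] last by simp
    qed (use last in \<open>simp add: idx_last\<close>)
    fix i assume "i < dim_vec (0\<^sub>v s :: real Matrix.vec)"
    then have i: "i < length Ss" using assms(6) by simp
    \<comment> \<open>Classes of a partition are nonempty, so every coordinate is the index of some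
      simple state.\<close>
    then have "Ss ! i \<noteq> {}"
      using partition_onD3[OF partition_states[OF states]] nth_mem by metis
    then obtain C where "C \<in> Ss ! i" by auto
    with i show "vec_index v i = vec_index (0\<^sub>v s) i"
      using harmonic[of C] state_index_eq[OF states i, of C] Union_nth_states[OF states] assms(6)
      by auto
  qed (use v in simp)
  obtain N where N: "mat_inverse ?A = Some N" "N \<in> carrier_mat s s" "?A * N = 1\<^sub>m s"
    using mat_inverse_eq_SomeI[OF A ker] .
  \<comment> \<open>This column solves the system whose right-hand side is the last unit vector, and
    its entry 0 is the one sought.\<close>
  define x where "x = Matrix.col N (s - 1)"
  have x: "x \<in> carrier_vec s" using N(2) by (auto simp: x_def intro: carrier_vecI)
  have Ax: "?A *\<^sub>v x = unit_vec s (s - 1)"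
    using col_mult2[OF A N(2) s(2)] N(3) s by (simp add: x_def)
  have last: "vec_index x (s - 1) = -1" using row_last[OF x, unfolded Ax] s by simp
  \<comment> \<open>Adding 1 makes the value at the final state 0 and is the \<open>+ 1\<close> of
    the formula. One-round probabilities sum to 1, so the shift passes through the average.\<close>
  define H where "H C = vec_index x (?idx C) + 1" for C
  have "H C = 1 + (\<Sum>D\<in>Pow (pverts G). round_prob G C {D} * H D)"
    if C: "C \<in> simple_states G B" and ne: "C \<noteq> pverts G" for C
  proof -
    obtain i where i: "i < length Ss" "C \<in> Ss ! i" using simple_state_in_nth[OF states C] .
    \<comment> \<open>The last class contains only \<open>pverts G\<close>, so in the row of a
      nonfinal \<open>C\<close> the right-hand side is 0.\<close>
    have "?idx C \<noteq> s - 1"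
      using i ne state_index_eq[OF states i] states assms(6)
      by (auto simp: ordered_state_list_def last_conv_nth)
    then have "(\<Sum>D\<in>Pow (pverts G). round_prob G C {D} * vec_index x (?idx D)) =
        vec_index x (?idx C) - 1"
      using row[OF x C, unfolded Ax] idx[OF C] s last by simp
    moreover have "C \<subseteq> pverts G" by (rule simple_states_bounds[OF B(1) C])
    ultimately show ?thesis
      using sum_round_prob[of C] by (simp add: H_def distrib_left sum.distrib)
  qed
  moreover have "H (pverts G) = 0" using last by (simp add: H_def idx_last)
  ultimately have "white_prob B sums H B"
    using white_prob_sums_hitting_time[OF con B] simple_states.initial by blast
  then have "ept G B = ereal (H B)"
    using ept_eq_suminf[OF B(1)] sums_unique sums_summable by metis
  also have "?idx B = 0"
    using state_index_eq[OF states _ initial_first_state[OF states]] s assms(6) by simp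
  then have "H B = N $$ (0, s - 1) + 1"
    using N(2) s by (simp add: H_def x_def)
  finally show ?thesis using N(1) by auto
qed

end
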